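(* Let $K$ be a field, let $g_1,\dots,g_r\in P=K[a_0,a_1,\dots,a_n]$, let $S=K[g_1,\dots,g_r]$, and let $g\in S\setminus\{0\}$. Let $\{H_1,\dots,H_t\}$ be a set of generators of the ideal $\mathrm{Rel}_g(g_1,\dots,g_r)\subseteq K[x_1,\dots,x_r]$, and for $i=1,\dots,t$ let $\tilde h_i=H_i(g_1,\dots,g_r)/g$ and $h_i=H_i(g_1,\dots,g_r):g^\infty$. Then $$S\subseteq K[S:g]=K[g_1,\dots,g_r,\tilde h_1,\dots,\tilde h_t]\subseteq K[g_1,\dots,g_r,h_1,\dots,h_t]\subseteq S:g^\infty .$$
   Context: For a subset $T\subseteq P$, $K[T]$ denotes the $K$-subalgebra of $P$ generated by $T$. For a subalgebra $S$ of $P$: $S:g=\{f\in P\mid gf\in S\}$, $S:g^i=\{f\in P\mid g^if\in S\}$, and $S:g^\infty=\bigcup_{i\in\mathbb N}(S:g^i)$. The ideal of relations of $g_1,\dots,g_r$ modulo $g$, denoted $\mathrm{Rel}_g(g_1,\dots,g_r)$, is the kernel of the composition $K[x_1,\dots,x_r]\to P\to P/\langle g\rangle$, where the first map is the $K$-algebra homomorphism with $x_i\mapsto g_i$ and the second is the canonical projection. In particular $g$ divides $H(g_1,\dots,g_r)$ in $P$ for each $H\in \mathrm{Rel}_g(g_1,\dots,g_r)$. For a polynomial $f\in P$, the saturation $f:g^\infty$ of $f$ with respect to $g$ is the polynomial $f/g^i$, where $g^i$ is the highest power of $g$ dividing $f$; by convention $f:g^\infty=f$ if $f=0$ or $g$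 is a constant. *)

theory Defs
  imports "HOL-Library.Poly_Mapping" "HOL-Algebra.QuotRing" "HOL-Algebra.Divisibility"
    "HOL-Algebra.Generated_Rings"
begin

text \<open>
  Polynomials in indeterminates indexed by the natural numbers: a monomial is a finitely supported
  exponent vector, a polynomial a finitely supported family of coefficients. The type
  \<open>'k mpoly\<close> is a commutative ring by the instances in \<open>Poly_Mapping\<close>; the polynomial rings in
  finitely many indeterminates are carved out of it as carrier sets.
\<close>

type_synonym 'k mpoly = "(nat \<Rightarrow>\<^sub>0 nat) \<Rightarrow>\<^sub>0 'k"

definition mconst :: "'k::field \<Rightarrow> 'k mpoly"
  where "mconst c = Poly_Mapping.single 0 c"

definition mpoly_ring :: "nat set \<Rightarrow> 'k::field mpoly ring"
  where "mpoly_ring X =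
    \<lparr>carrier = {p. \<forall>m\<in>Poly_Mapping.keys p. Poly_Mapping.keys m \<subseteq> X},
     mult = (*), one = 1, zero = 0, add = (+)\<rparr>"

text \<open>The \<open>K\<close>-algebra homomorphism sending the \<open>i\<close>-th indeterminate to \<open>gs i\<close>.\<close>

definition mpoly_subst :: "(nat \<Rightarrow> 'k::field mpoly) \<Rightarrow> 'k mpoly \<Rightarrow> 'k mpoly"
  where "mpoly_subst gs H =
    (\<Sum>m\<in>Poly_Mapping.keys H. mconst (Poly_Mapping.lookup H m) *
       (\<Prod>i\<in>Poly_Mapping.keys m. gs i ^ Poly_Mapping.lookup m i))"

text \<open>A \<open>K\<close>-subalgebra is a subring containing the constants, so \<open>K[T]\<close> is the subring generated by
  \<open>K \<union> T\<close>.\<close>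

definition algebra_generated :: "'k::field mpoly ring \<Rightarrow> 'k mpoly set \<Rightarrow> 'k mpoly set"
  where "algebra_generated P T = generate_ring P (range mconst \<union> T)"

definition colon :: "'a ring \<Rightarrow> 'a set \<Rightarrow> 'a \<Rightarrow> 'a set"
  where "colon P S g = {f \<in> carrier P. g \<otimes>\<^bsub>P\<^esub> f \<in> S}"

definition colon_saturation :: "'a ring \<Rightarrow> 'a set \<Rightarrow> 'a \<Rightarrow> 'a set"
  where "colon_saturation P S g = (\<Union>i::nat. colon P S (g [^]\<^bsub>P\<^esub> i))"

definition relation_ideal ::
    "'k::field mpoly ring \<Rightarrow> nat \<Rightarrow> (nat \<Rightarrow> 'k mpoly) \<Rightarrow> 'k mpoly \<Rightarrow> 'k mpoly set"
  where "relation_ideal P r gs g =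
    a_kernel (mpoly_ring {1..r}) (P Quot (Idl\<^bsub>P\<^esub> {g}))
      ((\<lambda>f. Idl\<^bsub>P\<^esub> {g} +>\<^bsub>P\<^esub> f) \<circ> mpoly_subst gs)"

text \<open>Exact quotient in an integral domain; only meaningful if \<open>b\<close> is nonzero and divides \<open>a\<close>.\<close>

definition exact_quotient :: "'a ring \<Rightarrow> 'a \<Rightarrow> 'a \<Rightarrow> 'a"
  where "exact_quotient P a b = (THE q. q \<in> carrier P \<and> a = b \<otimes>\<^bsub>P\<^esub> q)"

definition poly_saturation :: "'k::field mpoly ring \<Rightarrow> 'k mpoly \<Rightarrow> 'k mpoly \<Rightarrow> 'k mpoly"
  where "poly_saturation P f g =
    (if f = 0 \<or> g \<in> range mconst then f
     else exact_quotient P f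
       (g [^]\<^bsub>P\<^esub> (GREATEST i::nat. (g [^]\<^bsub>P\<^esub> i) divides\<^bsub>P\<^esub> f)))"

end

theory Submission
  imports Defs "HOL-Computational_Algebra.Polynomial"
begin

text \<open>
  Write \<open>F(g\<^sub>1,\<dots>,g\<^sub>r)\<close> for \<open>mpoly_subst gs F\<close>. Evaluation is a homomorphism of \<open>K\<close>-algebras whose
  image is \<open>S\<close>, and a polynomial \<open>F\<close> lies in the ideal of relations exactly if \<open>g\<close> divides
  \<open>F(g\<^sub>1,\<dots>,g\<^sub>r)\<close> in \<open>P\<close> (\<open>relation_ideal_iff\<close>).

  If \<open>g f \<in> S\<close>, then \<open>g f = F(g\<^sub>1,\<dots>,g\<^sub>r)\<close> for a relation \<open>F\<close>. The polynomials \<open>F\<close> such that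
  \<open>F(g\<^sub>1,\<dots>,g\<^sub>r)\<close> is \<open>g\<close> times an element of \<open>K[gs, h_tilde]\<close> form an ideal
  (\<open>ideal_mpoly_subst_multiples\<close>) that contains every \<open>H i\<close>, hence all relations; cancelling \<open>g\<close>
  gives \<open>f \<in> K[gs, h_tilde]\<close>. Conversely \<open>g\<close> times any of the generators \<open>gs i\<close>, \<open>h_tilde i\<close> lies in
  \<open>S\<close>. This is the equality of the two algebras in the middle.

  For the remaining inclusions, \<open>h_tilde i\<close> is \<open>h i\<close> times a power of \<open>g\<close>, or times the inverse of \<open>g\<close>
  if \<open>g\<close> is constant, and some power of \<open>g\<close> times \<open>h i\<close> is \<open>H\<^sub>i(g\<^sub>1,\<dots>,g\<^sub>r) \<in> S\<close>
  (\<open>quotient_and_saturation\<close>). Here the highest power of \<open>g\<close> dividing a nonzero polynomial must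
  exist, because the total degree is additive on products and positive for nonconstant \<open>g\<close>
  (\<open>power_dvd_bounded\<close>). The total degree is obtained as the degree in \<open>X\<close> after the
  substitution of \<open>a\<^sub>j X\<close> for each indeterminate \<open>a\<^sub>j\<close>.
\<close>

section \<open>Evaluation homomorphisms\<close>

text \<open>The value of a polynomial under a map \<open>c\<close> on coefficients and a map \<open>v\<close> on monomials. Monomials
  may form any additive monoid, so that the same facts serve for \<open>mpoly_subst\<close> and for the
  homogenisation below.\<close>

definition monomial_eval :: "('c::zero \<Rightarrow> 'b::comm_semiring_1) \<Rightarrow> ('m \<Rightarrow> 'b) \<Rightarrow> ('m \<Rightarrow>\<^sub>0 'c) \<Rightarrow> 'b"
  where "monomial_eval c v p =
    (\<Sum>m\<in>Poly_Mapping.keys p. c (Poly_Mapping.lookup p m) * v m)"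

lemma poly_mapping_eq_sum_single:
  fixes p :: "'m \<Rightarrow>\<^sub>0 'c::comm_monoid_add"
  shows "p = (\<Sum>m\<in>Poly_Mapping.keys p. Poly_Mapping.single m (Poly_Mapping.lookup p m))"
proof (rule poly_mapping_eqI)
  fix k
  have "Poly_Mapping.lookup (\<Sum>m\<in>Poly_Mapping.keys p. Poly_Mapping.single m (Poly_Mapping.lookup p m)) k
      = (\<Sum>m\<in>Poly_Mapping.keys p. if m = k then Poly_Mapping.lookup p m else 0)"
    by (simp add: lookup_sum lookup_single when_def)
  also have "\<dots> = Poly_Mapping.lookup p k"
    by (simp add: sum.delta in_keys_iff)
  finally show "Poly_Mapping.lookup p k = Poly_Mapping.lookup
      (\<Sum>m\<in>Poly_Mapping.keys p. Poly_Mapping.single m (Poly_Mapping.lookup p m)) k" ..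
qed

context
  fixes c :: "'c::comm_semiring_1 \<Rightarrow> 'b::comm_semiring_1"
    and v :: "'m::comm_monoid_add \<Rightarrow> 'b"
  assumes c_zero: "c 0 = 0" and c_one: "c 1 = 1"
    and c_add: "\<And>x y. c (x + y) = c x + c y"
    and c_mult: "\<And>x y. c (x * y) = c x * c y"
    and v_zero: "v 0 = 1"
    and v_add: "\<And>m n. v (m + n) = v m * v n"
begin

lemma monomial_eval_superset:
  assumes "finite A" "Poly_Mapping.keys p \<subseteq> A"
  shows "monomial_eval c v p = (\<Sum>m\<in>A. c (Poly_Mapping.lookup p m) * v m)"
  unfolding monomial_eval_def
  by (rule sum.mono_neutral_left) (use assms in \<open>auto simp: in_keys_iff c_zero\<close>)

lemma monomial_eval_single: "monomial_eval c v (Poly_Mapping.single m x) = c x * v m"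
  by (subst monomial_eval_superset[of "{m}"]) (auto simp: c_zero)

lemma monomial_eval_zero: "monomial_eval c v 0 = 0"
  by (simp add: monomial_eval_def)

lemma monomial_eval_one: "monomial_eval c v 1 = 1"
  using monomial_eval_single[of 0 1] by (simp add: c_one v_zero)

lemma monomial_eval_add: "monomial_eval c v (p + q) = monomial_eval c v p + monomial_eval c v q"
proof -
  let ?A = "Poly_Mapping.keys p \<union> Poly_Mapping.keys q"
  have "monomial_eval c v (p + q) = (\<Sum>m\<in>?A. c (Poly_Mapping.lookup (p + q) m) * v m)"
    by (rule monomial_eval_superset) (auto dest: keys_add[THEN subsetD])
  also have "\<dots> = (\<Sum>m\<in>?A. c (Poly_Mapping.lookup p m) * v m)
      + (\<Sum>m\<in>?A. c (Poly_Mapping.lookup q m) * v m)"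
    by (simp add: lookup_add c_add distrib_right sum.distrib)
  also have "\<dots> = monomial_eval c v p + monomial_eval c v q"
    by (simp add: monomial_eval_superset[of ?A])
  finally show ?thesis .
qed

lemma monomial_eval_sum: "monomial_eval c v (\<Sum>i\<in>I. f i) = (\<Sum>i\<in>I. monomial_eval c v (f i))"
  by (induction I rule: infinite_finite_induct)
    (simp_all add: monomial_eval_zero monomial_eval_add)

lemma monomial_eval_mult: "monomial_eval c v (p * q) = monomial_eval c v p * monomial_eval c v q"
proof -
  let ?s = "\<lambda>p m. Poly_Mapping.single m (Poly_Mapping.lookup p m)"
  have "p * q = (\<Sum>m\<in>Poly_Mapping.keys p. ?s p m) * (\<Sum>n\<in>Poly_Mapping.keys q. ?s q n)"
    using poly_mapping_eq_sum_single[of p] poly_mapping_eq_sum_single[of q] by metis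
  also have "\<dots> = (\<Sum>m\<in>Poly_Mapping.keys p. \<Sum>n\<in>Poly_Mapping.keys q.
      Poly_Mapping.single (m + n) (Poly_Mapping.lookup p m * Poly_Mapping.lookup q n))"
    by (simp add: sum_product mult_single)
  also have "monomial_eval c v \<dots> = (\<Sum>m\<in>Poly_Mapping.keys p. \<Sum>n\<in>Poly_Mapping.keys q.
      c (Poly_Mapping.lookup p m) * v m * (c (Poly_Mapping.lookup q n) * v n))"
    by (simp add: monomial_eval_sum monomial_eval_single c_mult v_add mult_ac)
  also have "\<dots> = monomial_eval c v p * monomial_eval c v q"
    by (simp add: monomial_eval_def sum_product)
  finally show ?thesis .
qed

end

lemma mconst_zero: "mconst 0 = 0"
  and mconst_one: "mconst 1 = 1"
  and mconst_add: "mconst (a + b) = mconst a + mconst b"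
  and mconst_mult: "mconst (a * b) = mconst a * mconst b"
  by (simp_all add: mconst_def single_add mult_single)

lemma mconst_minus_one_mult: "mconst (- 1) * x = - x"
proof -
  have "mconst (- 1) = - (1 :: 'a mpoly)"
    by (simp add: mconst_def single_uminus)
  then show ?thesis by simp
qed

lemma prod_power_lookup_superset:
  fixes gs :: "'i \<Rightarrow> 'b::comm_semiring_1"
  assumes "finite A" "Poly_Mapping.keys m \<subseteq> A"
  shows "(\<Prod>i\<in>Poly_Mapping.keys m. gs i ^ Poly_Mapping.lookup m i)
    = (\<Prod>i\<in>A. gs i ^ Poly_Mapping.lookup m i)"
  by (rule prod.mono_neutral_left) (use assms in \<open>auto simp: in_keys_iff\<close>)

lemma prod_power_lookup_add:
  fixes gs :: "'i \<Rightarrow> 'b::comm_semiring_1"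
  shows "(\<Prod>i\<in>Poly_Mapping.keys (m + n). gs i ^ Poly_Mapping.lookup (m + n) i)
    = (\<Prod>i\<in>Poly_Mapping.keys m. gs i ^ Poly_Mapping.lookup m i)
      * (\<Prod>i\<in>Poly_Mapping.keys n. gs i ^ Poly_Mapping.lookup n i)"
proof -
  let ?A = "Poly_Mapping.keys m \<union> Poly_Mapping.keys n"
  have "(\<Prod>i\<in>Poly_Mapping.keys (m + n). gs i ^ Poly_Mapping.lookup (m + n) i)
      = (\<Prod>i\<in>?A. gs i ^ Poly_Mapping.lookup (m + n) i)"
    by (rule prod_power_lookup_superset) (auto dest: keys_add[THEN subsetD])
  also have "\<dots> = (\<Prod>i\<in>?A. gs i ^ Poly_Mapping.lookup m i)
      * (\<Prod>i\<in>?A. gs i ^ Poly_Mapping.lookup n i)"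
    by (simp add: lookup_add power_add prod.distrib)
  finally show ?thesis
    by (simp add: prod_power_lookup_superset[of ?A])
qed

lemma mpoly_subst_eq_monomial_eval:
  "mpoly_subst gs = monomial_eval mconst
    (\<lambda>m. \<Prod>i\<in>Poly_Mapping.keys m. gs i ^ Poly_Mapping.lookup m i)"
  by (simp add: fun_eq_iff mpoly_subst_def monomial_eval_def)

lemma mpoly_subst_zero: "mpoly_subst gs 0 = 0"
  by (simp add: mpoly_subst_def)

lemma mpoly_subst_add: "mpoly_subst gs (p + q) = mpoly_subst gs p + mpoly_subst gs q"
  unfolding mpoly_subst_eq_monomial_eval
  by (rule monomial_eval_add) (simp_all add: mconst_zero mconst_one mconst_add mconst_mult
    prod_power_lookup_add)

lemma mpoly_subst_mult: "mpoly_subst gs (p * q) = mpoly_subst gs p * mpoly_subst gs q"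
  unfolding mpoly_subst_eq_monomial_eval
  by (rule monomial_eval_mult) (simp_all add: mconst_zero mconst_one mconst_add mconst_mult
    prod_power_lookup_add)

lemma mpoly_subst_uminus: "mpoly_subst gs (- p) = - mpoly_subst gs p"
  using mpoly_subst_add[of gs p "- p"] by (simp add: mpoly_subst_zero eq_neg_iff_add_eq_0 add.commute)

lemma mpoly_subst_mconst: "mpoly_subst gs (mconst x) = mconst x"
  by (cases "x = 0") (simp_all add: mpoly_subst_def mconst_def)

lemma mpoly_subst_indeterminate:
  "mpoly_subst gs (Poly_Mapping.single (Poly_Mapping.single i 1) 1) = gs i"
  by (simp add: mpoly_subst_def mconst_one)


section \<open>The highest power dividing a polynomial\<close>

text \<open>The substitution of \<open>a\<^sub>j X\<close> for each indeterminate \<open>a\<^sub>j\<close>, with values in the univariate polynomials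
  in \<open>X\<close> over \<open>'k mpoly\<close>. The degree in \<open>X\<close> is the total degree, and \<open>X = 1\<close> gives back the polynomial.\<close>

definition homogenise :: "'k::field mpoly \<Rightarrow> 'k mpoly poly"
  where "homogenise = monomial_eval (\<lambda>x. [:mconst x:])
    (\<lambda>m. monom (Poly_Mapping.single m 1) (\<Sum>i\<in>Poly_Mapping.keys m. Poly_Mapping.lookup m i))"

lemma sum_lookup_add:
  fixes m n :: "'i \<Rightarrow>\<^sub>0 nat"
  shows "(\<Sum>i\<in>Poly_Mapping.keys (m + n). Poly_Mapping.lookup (m + n) i)
    = (\<Sum>i\<in>Poly_Mapping.keys m. Poly_Mapping.lookup m i)
      + (\<Sum>i\<in>Poly_Mapping.keys n. Poly_Mapping.lookup n i)"
  by (rule setsum_keys_plus_distrib) simp_all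

lemma homogenise_mult: "homogenise (p * q) = homogenise p * homogenise q"
  unfolding homogenise_def
  by (rule monomial_eval_mult)
    (simp_all add: mconst_zero mconst_one mconst_add mconst_mult sum_lookup_add mult_monom mult_single)

lemma homogenise_power: "homogenise (p ^ i) = homogenise p ^ i"
proof (induction i)
  case 0
  have "homogenise (1 :: 'a mpoly) = 1"
    unfolding homogenise_def
    by (rule monomial_eval_one)
      (simp_all add: mconst_zero mconst_one mconst_add mconst_mult sum_lookup_add mult_monom mult_single)
  then show ?case by simp
qed (simp add: homogenise_mult)

lemma poly_homogenise_1: "poly (homogenise p) 1 = p"
proof -
  have "poly (homogenise p) 1
      = (\<Sum>m\<in>Poly_Mapping.keys p. Poly_Mapping.single m (Poly_Mapping.lookup p m))"
    by (simp add: homogenise_def monomial_eval_def poly_sum poly_monom mconst_def mult_single)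
  then show ?thesis
    using poly_mapping_eq_sum_single[of p] by simp
qed

lemma mconst_if_degree_homogenise_0:
  assumes "degree (homogenise p) = 0"
  shows "p \<in> range mconst"
proof -
  have "homogenise p = [:coeff (homogenise p) 0:]"
    using assms by (metis degree_0_id)
  then have "p = coeff (homogenise p) 0"
    using poly_homogenise_1[of p] by (metis mult_zero_right add.right_neutral poly_pCons poly_0)
  also have "\<dots> = (\<Sum>m\<in>Poly_Mapping.keys p. if m = 0 then mconst (Poly_Mapping.lookup p m) else 0)"
    unfolding homogenise_def monomial_eval_def coeff_sum
  proof (rule sum.cong, rule refl)
    fix m assume "m \<in> Poly_Mapping.keys p"
    have "(\<Sum>i\<in>Poly_Mapping.keys m. Poly_Mapping.lookup m i) = 0 \<longleftrightarrow> m = 0"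
      by (auto simp: in_keys_iff intro: poly_mapping_eqI)
    then show "coeff ([:mconst (Poly_Mapping.lookup p m):]
        * monom (Poly_Mapping.single m 1) (\<Sum>i\<in>Poly_Mapping.keys m. Poly_Mapping.lookup m i)) 0
      = (if m = 0 then mconst (Poly_Mapping.lookup p m) else 0)"
      by (simp add: mconst_def mult_single del: sum_eq_0_iff)
  qed
  also have "\<dots> = mconst (Poly_Mapping.lookup p 0)"
    by (simp add: sum.delta in_keys_iff mconst_zero)
  finally show ?thesis by blast
qed

lemma power_dvd_bounded:
  fixes f g :: "'k::field mpoly"
  assumes "f \<noteq> 0" "g \<notin> range mconst" "g ^ i dvd f"
  shows "i \<le> degree (homogenise f)"
proof -
  obtain q where q: "f = g ^ i * q" using assms(3) by blast
  have g0: "homogenise g \<noteq> 0"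
    using poly_homogenise_1[of g] assms(2) mconst_zero[where ?'a = 'k, symmetric] by auto
  have f0: "homogenise f \<noteq> 0"
    using poly_homogenise_1[of f] assms(1) by auto
  have eq: "homogenise f = homogenise g ^ i * homogenise q"
    by (simp add: q homogenise_mult homogenise_power)
  have "degree (homogenise f) = i * degree (homogenise g) + degree (homogenise q)"
  proof -
    have "homogenise g ^ i \<noteq> 0" "homogenise q \<noteq> 0" using f0 eq by auto
    then have "degree (homogenise f) = degree (homogenise g ^ i) + degree (homogenise q)"
      unfolding eq by (rule degree_mult_eq)
    then show ?thesis by (simp add: degree_power_eq[OF g0])
  qed
  moreover have "degree (homogenise g) \<ge> 1"
    using mconst_if_degree_homogenise_0[of g] assms(2) by linarith
  ultimately show ?thesis
    by (metis le_add1 le_trans mult.right_neutral mult_le_mono2)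
qed


section \<open>Polynomial rings and generated subalgebras\<close>

lemma mpoly_ring_simps:
  "\<one>\<^bsub>mpoly_ring X\<^esub> = 1" "\<zero>\<^bsub>mpoly_ring X\<^esub> = 0"
  "x \<otimes>\<^bsub>mpoly_ring X\<^esub> y = x * y" "x \<oplus>\<^bsub>mpoly_ring X\<^esub> y = x + y"
  by (simp_all add: mpoly_ring_def)

lemma mpoly_ring_pow: "x [^]\<^bsub>mpoly_ring X\<^esub> (i::nat) = x ^ i"
  by (induction i) (simp_all add: nat_pow_def mpoly_ring_simps mult.commute)

lemma mconst_in_mpoly_ring: "mconst x \<in> carrier (mpoly_ring X)"
  by (simp add: mpoly_ring_def mconst_def)

lemma add_in_mpoly_ring:
  "p \<in> carrier (mpoly_ring X) \<Longrightarrow> q \<in> carrier (mpoly_ring X) \<Longrightarrow> p + q \<in> carrier (mpoly_ring X)"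
  using keys_add[of p q] by (fastforce simp: mpoly_ring_def)

lemma uminus_in_mpoly_ring: "p \<in> carrier (mpoly_ring X) \<Longrightarrow> - p \<in> carrier (mpoly_ring X)"
  by (simp add: mpoly_ring_def)

lemma mult_in_mpoly_ring:
  assumes "p \<in> carrier (mpoly_ring X)" "q \<in> carrier (mpoly_ring X)"
  shows "p * q \<in> carrier (mpoly_ring X)"
proof -
  have "Poly_Mapping.keys m \<subseteq> X" if m: "m \<in> Poly_Mapping.keys (p * q)" for m
  proof -
    obtain a b where ab: "m = a + b" "a \<in> Poly_Mapping.keys p" "b \<in> Poly_Mapping.keys q"
      using m keys_mult[of p q] by blast
    then have "Poly_Mapping.keys a \<subseteq> X" "Poly_Mapping.keys b \<subseteq> X"
      using assms by (auto simp: mpoly_ring_def)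
    then show ?thesis using ab(1) keys_add[of a b] by blast
  qed
  then show ?thesis by (simp add: mpoly_ring_def)
qed

lemma cring_mpoly_ring: "cring (mpoly_ring X :: 'k::field mpoly ring)"
proof (rule cringI)
  have 0: "(0 :: 'k mpoly) \<in> carrier (mpoly_ring X)"
    using mconst_in_mpoly_ring[of 0 X] by (simp add: mconst_zero)
  have 1: "(1 :: 'k mpoly) \<in> carrier (mpoly_ring X)"
    using mconst_in_mpoly_ring[of 1 X] by (simp add: mconst_one)
  show "abelian_group (mpoly_ring X :: 'k mpoly ring)"
    by (rule abelian_groupI)
      (auto simp: mpoly_ring_simps add_in_mpoly_ring 0 add_ac intro!: bexI[of _ "- x" for x]
        uminus_in_mpoly_ring)
  show "comm_monoid (mpoly_ring X :: 'k mpoly ring)"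
    by (rule comm_monoidI) (auto simp: mpoly_ring_simps mult_in_mpoly_ring 1 mult_ac)
qed (auto simp: mpoly_ring_simps distrib_right)

lemma mpoly_ring_a_inv:
  assumes "x \<in> carrier (mpoly_ring X)"
  shows "\<ominus>\<^bsub>mpoly_ring X\<^esub> x = - x"
proof -
  interpret cring "mpoly_ring X" by (rule cring_mpoly_ring)
  show ?thesis
    by (rule minus_equality) (use assms in \<open>auto simp: mpoly_ring_simps uminus_in_mpoly_ring\<close>)
qed

lemma mpoly_ring_divides_iff:
  "a divides\<^bsub>mpoly_ring X\<^esub> b \<longleftrightarrow> (\<exists>q\<in>carrier (mpoly_ring X). b = a * q)"
  by (simp add: factor_def mpoly_ring_simps)

lemma mpoly_ring_exact_quotient:
  assumes "q \<in> carrier (mpoly_ring X)" "b \<noteq> 0"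
  shows "exact_quotient (mpoly_ring X) (b * q) b = q"
  unfolding exact_quotient_def by (rule the_equality) (use assms in \<open>auto simp: mpoly_ring_simps\<close>)

lemma mconst_in_algebra_generated: "mconst x \<in> algebra_generated P T"
  by (simp add: algebra_generated_def generate_ring.incl)

lemma generator_in_algebra_generated: "x \<in> T \<Longrightarrow> x \<in> algebra_generated P T"
  by (simp add: algebra_generated_def generate_ring.incl)

lemma add_in_algebra_generated:
  "x \<in> algebra_generated (mpoly_ring X) T \<Longrightarrow> y \<in> algebra_generated (mpoly_ring X) T
    \<Longrightarrow> x + y \<in> algebra_generated (mpoly_ring X) T"
  using generate_ring.eng_add[of x "mpoly_ring X"]
  by (simp add: algebra_generated_def mpoly_ring_simps)

lemma mult_in_algebra_generated:
  "x \<in> algebra_generated (mpoly_ring X) T \<Longrightarrow> y \<in> algebra_generated (mpoly_ring X) T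
    \<Longrightarrow> x * y \<in> algebra_generated (mpoly_ring X) T"
  using generate_ring.eng_mult[of x "mpoly_ring X"]
  by (simp add: algebra_generated_def mpoly_ring_simps)

lemma zero_in_algebra_generated: "0 \<in> algebra_generated P T"
  using mconst_in_algebra_generated[of 0] by (simp add: mconst_zero)

lemma one_in_algebra_generated: "1 \<in> algebra_generated P T"
  using mconst_in_algebra_generated[of 1] by (simp add: mconst_one)

lemma uminus_in_algebra_generated:
  assumes "x \<in> algebra_generated (mpoly_ring X) T"
  shows "- x \<in> algebra_generated (mpoly_ring X) T"
  using mult_in_algebra_generated[OF mconst_in_algebra_generated[of "-1"] assms]
  by (simp add: mconst_minus_one_mult)

lemma power_in_algebra_generated:
  "x \<in> algebra_generated (mpoly_ring X) T \<Longrightarrow> x ^ i \<in> algebra_generated (mpoly_ring X) T"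
  by (induction i) (auto intro: one_in_algebra_generated mult_in_algebra_generated)

lemma sum_in_algebra_generated:
  "(\<And>i. i \<in> I \<Longrightarrow> f i \<in> algebra_generated (mpoly_ring X) T)
    \<Longrightarrow> (\<Sum>i\<in>I. f i) \<in> algebra_generated (mpoly_ring X) T"
  by (induction I rule: infinite_finite_induct)
    (auto intro: zero_in_algebra_generated add_in_algebra_generated)

lemma prod_in_algebra_generated:
  "(\<And>i. i \<in> I \<Longrightarrow> f i \<in> algebra_generated (mpoly_ring X) T)
    \<Longrightarrow> (\<Prod>i\<in>I. f i) \<in> algebra_generated (mpoly_ring X) T"
  by (induction I rule: infinite_finite_induct)
    (auto intro: one_in_algebra_generated mult_in_algebra_generated)

lemma algebra_generated_in_mpoly_ring:
  assumes "T \<subseteq> carrier (mpoly_ring X)"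
  shows "algebra_generated (mpoly_ring X) T \<subseteq> carrier (mpoly_ring X)"
proof -
  interpret cring "mpoly_ring X" by (rule cring_mpoly_ring)
  show ?thesis unfolding algebra_generated_def
    by (rule generate_ring_incl) (use assms mconst_in_mpoly_ring in auto)
qed

text \<open>Closure under additive inverses need not be required of \<open>E\<close>, because \<open>-1\<close> is a constant.\<close>

lemma algebra_generated_least:
  assumes T: "T \<subseteq> carrier (mpoly_ring X)" "T \<subseteq> E"
    and const: "\<And>x. mconst x \<in> E"
    and add: "\<And>x y. x \<in> E \<Longrightarrow> y \<in> E \<Longrightarrow> x + y \<in> E"
    and mult: "\<And>x y. x \<in> E \<Longrightarrow> y \<in> E \<Longrightarrow> x * y \<in> E"
  shows "algebra_generated (mpoly_ring X) T \<subseteq> E"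
proof -
  let ?P = "mpoly_ring X" and ?E = "E \<inter> carrier (mpoly_ring X)"
  interpret cring ?P by (rule cring_mpoly_ring)
  have uminus: "- x \<in> E" if "x \<in> E" for x
    using mult[OF const[of "-1"] that] by (simp add: mconst_minus_one_mult)
  have "1 \<in> E" using const[of 1] by (simp add: mconst_one)
  then have "subring ?E ?P"
    by (intro subringI)
      (use one_closed in \<open>auto simp: mpoly_ring_simps mpoly_ring_a_inv uminus uminus_in_mpoly_ring
        add mult add_in_mpoly_ring mult_in_mpoly_ring\<close>)
  then have "generate_ring ?P (range mconst \<union> T) \<subseteq> ?E"
    by (intro generate_ring_min_subring1) (use T const mconst_in_mpoly_ring in auto)
  then show ?thesis by (auto simp: algebra_generated_def)
qed

lemma algebra_generated_subset:
  assumes "T \<subseteq> carrier (mpoly_ring X)" "T \<subseteq> algebra_generated (mpoly_ring X) U"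
  shows "algebra_generated (mpoly_ring X) T \<subseteq> algebra_generated (mpoly_ring X) U"
  by (rule algebra_generated_least)
    (use assms in \<open>auto intro: mconst_in_algebra_generated add_in_algebra_generated
      mult_in_algebra_generated\<close>)

lemma mpoly_subst_in_algebra_generated:
  assumes "F \<in> carrier (mpoly_ring Y)"
  shows "mpoly_subst gs F \<in> algebra_generated (mpoly_ring X) (gs ` Y)"
  unfolding mpoly_subst_def
proof (intro sum_in_algebra_generated mult_in_algebra_generated mconst_in_algebra_generated
    prod_in_algebra_generated power_in_algebra_generated)
  fix m i assume "m \<in> Poly_Mapping.keys F" "i \<in> Poly_Mapping.keys m"
  then have "i \<in> Y" using assms by (auto simp: mpoly_ring_def)
  then show "gs i \<in> algebra_generated (mpoly_ring X) (gs ` Y)"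
    by (auto intro: generator_in_algebra_generated)
qed

lemma algebra_generated_eq_mpoly_subst_image:
  assumes "gs ` Y \<subseteq> carrier (mpoly_ring X)"
  shows "algebra_generated (mpoly_ring X) (gs ` Y) = mpoly_subst gs ` carrier (mpoly_ring Y)"
    (is "?A = ?B")
proof
  show "?A \<subseteq> ?B"
  proof (rule algebra_generated_least[OF assms])
    show "gs ` Y \<subseteq> ?B"
    proof
      fix y assume "y \<in> gs ` Y"
      then obtain i where "i \<in> Y" "y = gs i" by blast
      then show "y \<in> ?B"
        by (intro image_eqI[of _ _ "Poly_Mapping.single (Poly_Mapping.single i 1) 1"])
          (simp_all only: mpoly_subst_indeterminate, auto simp: mpoly_ring_def)
    qed
    show "mconst x \<in> ?B" for x
      by (rule image_eqI[of _ _ "mconst x"]) (simp_all add: mpoly_subst_mconst mconst_in_mpoly_ring)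
    show "x + y \<in> ?B" if "x \<in> ?B" "y \<in> ?B" for x y
      using that by (auto simp flip: mpoly_subst_add intro!: imageI add_in_mpoly_ring)
    show "x * y \<in> ?B" if "x \<in> ?B" "y \<in> ?B" for x y
      using that by (auto simp flip: mpoly_subst_mult intro!: imageI mult_in_mpoly_ring)
  qed
  show "?B \<subseteq> ?A"
    using mpoly_subst_in_algebra_generated by blast
qed


section \<open>Relations, colons and saturations\<close>

lemma relation_ideal_iff:
  fixes gs :: "nat \<Rightarrow> 'k::field mpoly"
  assumes gs: "gs ` {1..r} \<subseteq> carrier (mpoly_ring X)"
    and g: "g \<in> carrier (mpoly_ring X)"
  shows "F \<in> relation_ideal (mpoly_ring X) r gs g \<longleftrightarrow>
    F \<in> carrier (mpoly_ring {1..r}) \<and> g divides\<^bsub>mpoly_ring X\<^esub> mpoly_subst gs F"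
proof -
  let ?P = "mpoly_ring X :: 'k mpoly ring"
  interpret P: cring ?P by (rule cring_mpoly_ring)
  have ideal: "ideal (Idl\<^bsub>?P\<^esub> {g}) ?P"
    by (rule P.genideal_ideal) (use g in simp)
  have "Idl\<^bsub>?P\<^esub> {g} +>\<^bsub>?P\<^esub> x = Idl\<^bsub>?P\<^esub> {g} \<longleftrightarrow> x \<in> Idl\<^bsub>?P\<^esub> {g}"
    if "x \<in> carrier ?P" for x
    using P.a_rcos_zero[OF ideal] P.a_coset_join1[OF _ that]
      additive_subgroup.a_subgroup[OF ideal.axioms(1)[OF ideal]] by blast
  moreover have "x \<in> Idl\<^bsub>?P\<^esub> {g} \<longleftrightarrow> g divides\<^bsub>?P\<^esub> x" for x
    unfolding P.cgenideal_eq_genideal[OF g, symmetric]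
    by (auto simp: cgenideal_def mpoly_ring_divides_iff mpoly_ring_simps mult.commute)
  moreover have "mpoly_subst gs F \<in> carrier ?P" if "F \<in> carrier (mpoly_ring {1..r})"
    using mpoly_subst_in_algebra_generated[OF that] algebra_generated_in_mpoly_ring[OF gs] by blast
  ultimately show ?thesis
    by (auto simp: relation_ideal_def a_kernel_def' FactRing_def)
qed

lemma ideal_mpoly_subst_multiples:
  assumes "gs ` Y \<subseteq> T"
  shows "ideal {F \<in> carrier (mpoly_ring Y).
      \<exists>q\<in>algebra_generated (mpoly_ring X) T. mpoly_subst gs F = g * q} (mpoly_ring Y)"
    (is "ideal ?J ?R")
proof -
  let ?A = "algebra_generated (mpoly_ring X) T"
  interpret R: cring ?R by (rule cring_mpoly_ring)
  have subst: "mpoly_subst gs F \<in> ?A" if "F \<in> carrier ?R" for F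
  proof -
    have "mpoly_subst gs F \<in> generate_ring (mpoly_ring X) (range mconst \<union> gs ` Y)"
      using mpoly_subst_in_algebra_generated[OF that] by (simp add: algebra_generated_def)
    then show ?thesis
      unfolding algebra_generated_def
    proof induction
      case (incl x)
      then show ?case using assms by (intro generate_ring.incl) blast
    qed (auto intro: generate_ring.intros)
  qed
  have absorb: "F * G \<in> ?J" if G: "G \<in> ?J" and F: "F \<in> carrier ?R" for F G
  proof -
    obtain q where q: "q \<in> ?A" "mpoly_subst gs G = g * q" "G \<in> carrier ?R" using G by blast
    then have "mpoly_subst gs (F * G) = g * (mpoly_subst gs F * q)"
      by (simp add: mpoly_subst_mult mult_ac)
    then show ?thesis
      using q F mult_in_algebra_generated[OF subst[OF F] q(1)] by (auto simp: mult_in_mpoly_ring)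
  qed
  show ?thesis
  proof (rule idealI[OF R.ring_axioms])
    show "subgroup ?J (add_monoid ?R)"
    proof (rule R.add.subgroupI)
      show "?J \<noteq> {}"
        using R.zero_closed zero_in_algebra_generated[of "mpoly_ring X" T]
        by (auto simp: mpoly_ring_simps mpoly_subst_zero intro!: exI[of _ 0] bexI[of _ 0])
      show "\<ominus>\<^bsub>?R\<^esub> F \<in> ?J" if F: "F \<in> ?J" for F
      proof -
        obtain q where "q \<in> ?A" "mpoly_subst gs F = g * q" "F \<in> carrier ?R" using F by blast
        then show ?thesis
          by (auto simp: mpoly_ring_a_inv uminus_in_mpoly_ring mpoly_subst_uminus
            intro!: bexI[of _ "- q"] uminus_in_algebra_generated)
      qed
      show "F \<oplus>\<^bsub>?R\<^esub> G \<in> ?J" if F: "F \<in> ?J" and G: "G \<in> ?J" for F G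
      proof -
        obtain q q' where "q \<in> ?A" "mpoly_subst gs F = g * q" "F \<in> carrier ?R"
          "q' \<in> ?A" "mpoly_subst gs G = g * q'" "G \<in> carrier ?R" using F G by blast
        then show ?thesis
          by (auto simp: mpoly_ring_simps add_in_mpoly_ring mpoly_subst_add distrib_left
            intro!: bexI[of _ "q + q'"] add_in_algebra_generated)
      qed
    qed auto
    show "x \<otimes>\<^bsub>?R\<^esub> a \<in> ?J" if "a \<in> ?J" "x \<in> carrier ?R" for a x
      using absorb[OF that] by (simp only: mpoly_ring_simps)
    show "a \<otimes>\<^bsub>?R\<^esub> x \<in> ?J" if "a \<in> ?J" "x \<in> carrier ?R" for a x
      using absorb[OF that] by (simp only: mpoly_ring_simps mult.commute)
  qed
qed

lemma colon_mpoly_ring_iff: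
  "f \<in> colon (mpoly_ring X) S g \<longleftrightarrow> f \<in> carrier (mpoly_ring X) \<and> g * f \<in> S"
  by (simp add: colon_def mpoly_ring_simps)

lemma colon_saturation_mpoly_ring_iff:
  "f \<in> colon_saturation (mpoly_ring X) S g \<longleftrightarrow> f \<in> carrier (mpoly_ring X) \<and> (\<exists>i. g ^ i * f \<in> S)"
  by (auto simp: colon_saturation_def colon_mpoly_ring_iff mpoly_ring_pow)

lemma algebra_generated_subset_colon_saturation:
  assumes T: "T \<subseteq> colon_saturation (mpoly_ring X) (algebra_generated (mpoly_ring X) U) g"
    and g: "g \<in> algebra_generated (mpoly_ring X) U"
  shows "algebra_generated (mpoly_ring X) T
    \<subseteq> colon_saturation (mpoly_ring X) (algebra_generated (mpoly_ring X) U) g"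
proof (rule algebra_generated_least[OF _ T])
  let ?A = "algebra_generated (mpoly_ring X) U"
  let ?C = "colon_saturation (mpoly_ring X) ?A g"
  show "T \<subseteq> carrier (mpoly_ring X)"
    using T by (auto simp: colon_saturation_mpoly_ring_iff)
  show "mconst x \<in> ?C" for x
    by (auto simp: colon_saturation_mpoly_ring_iff mconst_in_mpoly_ring
      intro!: exI[of _ 0] mconst_in_algebra_generated)
  fix x y assume "x \<in> ?C" "y \<in> ?C"
  then obtain i j where ij: "x \<in> carrier (mpoly_ring X)" "g ^ i * x \<in> ?A"
    "y \<in> carrier (mpoly_ring X)" "g ^ j * y \<in> ?A"
    by (auto simp: colon_saturation_mpoly_ring_iff)
  have "g ^ (i + j) * (x * y) = (g ^ i * x) * (g ^ j * y)"
    by (simp add: power_add mult_ac)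
  also have "\<dots> \<in> ?A"
    by (rule mult_in_algebra_generated[OF ij(2,4)])
  finally show "x * y \<in> ?C"
    using ij mult_in_mpoly_ring unfolding colon_saturation_mpoly_ring_iff by blast
  have "g ^ (i + j) * (x + y) = g ^ j * (g ^ i * x) + g ^ i * (g ^ j * y)"
    by (simp add: power_add algebra_simps)
  also have "\<dots> \<in> ?A"
    by (intro add_in_algebra_generated mult_in_algebra_generated[OF _ ij(2)]
      mult_in_algebra_generated[OF _ ij(4)] power_in_algebra_generated g)
  finally show "x + y \<in> ?C"
    using ij add_in_mpoly_ring unfolding colon_saturation_mpoly_ring_iff by blast
qed

text \<open>Both \<open>f / g\<close> and \<open>f : g\<^sup>\<infinity>\<close> are described by products, so that no case distinction on the
  convention for zero \<open>f\<close> or constant \<open>g\<close> is needed later. For nonzero \<open>f\<close> the factor \<open>u\<close> is the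
  inverse of \<open>g\<close> if \<open>g\<close> is constant, and otherwise \<open>g ^ (i - 1)\<close>, where \<open>g ^ i\<close> is the highest power
  of \<open>g\<close> dividing \<open>f\<close>.\<close>

lemma quotient_and_saturation:
  fixes f g :: "'k::field mpoly"
  assumes f: "f \<in> carrier (mpoly_ring X)" and g0: "g \<noteq> 0" and dvd: "g divides\<^bsub>mpoly_ring X\<^esub> f"
  obtains i u where "poly_saturation (mpoly_ring X) f g \<in> carrier (mpoly_ring X)"
    and "g ^ i * poly_saturation (mpoly_ring X) f g = f"
    and "exact_quotient (mpoly_ring X) f g = u * poly_saturation (mpoly_ring X) f g"
    and "u \<in> range mconst \<union> range (\<lambda>j. g ^ j)"
proof -
  let ?P = "mpoly_ring X :: 'k mpoly ring" and ?h = "poly_saturation (mpoly_ring X) f g"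
  obtain q where q: "q \<in> carrier ?P" "f = g * q"
    using dvd by (auto simp: mpoly_ring_divides_iff)
  have quot: "exact_quotient ?P f g = q"
    using mpoly_ring_exact_quotient[OF q(1) g0] q(2) by simp
  consider "f = 0" | "f \<noteq> 0" "g \<in> range mconst" | "f \<noteq> 0" "g \<notin> range mconst" by blast
  then show thesis
  proof cases
    case 1
    \<comment> \<open>Both quotient and saturation are zero here, so any constant serves as \<open>u\<close>.\<close>
    then have "q = 0" "?h = f" using q(2) g0 by (auto simp: poly_saturation_def)
    then show ?thesis
      using that[of 0 "mconst 1"] f quot 1 by auto
  next
    case 2
    then obtain x where x: "g = mconst x" by blast
    then have "x \<noteq> 0" using g0 by (auto simp: mconst_zero)
    then have "mconst (inverse x) * g = 1"
      by (simp add: x mconst_one flip: mconst_mult)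
    then have "q = mconst (inverse x) * f" by (simp add: q(2) flip: mult.assoc)
    moreover have "?h = f" using 2 by (simp add: poly_saturation_def)
    ultimately show ?thesis
      using that[of 0 "mconst (inverse x)"] f quot by auto
  next
    case 3
    let ?D = "\<lambda>i::nat. (g [^]\<^bsub>?P\<^esub> i) divides\<^bsub>?P\<^esub> f"
    define k where "k = (GREATEST i::nat. ?D i)"
    have bound: "i \<le> degree (homogenise f)" if "?D i" for i
    proof (rule power_dvd_bounded[OF 3])
      show "g ^ i dvd f"
        using that by (auto simp: mpoly_ring_divides_iff mpoly_ring_pow)
    qed
    have D1: "?D 1" using dvd by (simp add: mpoly_ring_simps)
    have "?D k" unfolding k_def by (rule GreatestI_nat[where P = ?D, OF D1 bound])
    have "k \<ge> 1" unfolding k_def by (rule Greatest_le_nat[where P = ?D, OF D1 bound])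
    then obtain j where j: "k = Suc j" by (cases k) auto
    obtain s where s: "s \<in> carrier ?P" "f = g ^ k * s"
      using \<open>?D k\<close> by (auto simp: mpoly_ring_divides_iff mpoly_ring_pow)
    have "?h = exact_quotient ?P f (g ^ k)"
      unfolding poly_saturation_def k_def mpoly_ring_pow using 3 by (simp only: if_False simp_thms)
    also have "\<dots> = s"
      unfolding s(2) by (rule mpoly_ring_exact_quotient) (use s(1) g0 in auto)
    finally have h: "?h = s" .
    have "g * q = g * (g ^ j * s)"
      using q(2)[symmetric] s(2) unfolding j power_Suc mult.assoc by (rule trans)
    then have "q = g ^ j * s" unfolding mult_left_cancel[OF g0] .
    then show ?thesis
      using that[of k "g ^ j"] s(1) s(2)[symmetric] unfolding h quot by blast
  qed
qed


section \<open>The chain of subalgebras\<close>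

theorem theorem3p4:
  fixes n r t :: nat
    and P :: "'k::field mpoly ring"
    and S :: "'k mpoly set"
    and gs H h_tilde h :: "nat \<Rightarrow> 'k mpoly"
    and g :: "'k mpoly"
  assumes P: "P = mpoly_ring {0..n}"
    and gs: "\<And>i. i \<in> {1..r} \<Longrightarrow> gs i \<in> carrier P"
    and S: "S = algebra_generated P (gs ` {1..r})"
    and g: "g \<in> S - {0}"
    and H: "\<And>i. i \<in> {1..t} \<Longrightarrow> H i \<in> carrier (mpoly_ring {1..r})"
    and Rel: "Idl\<^bsub>mpoly_ring {1..r}\<^esub> (H ` {1..t}) = relation_ideal P r gs g"
    and h_tilde: "\<And>i. i \<in> {1..t} \<Longrightarrow> h_tilde i = exact_quotient P (mpoly_subst gs (H i)) g"
    and h: "\<And>i. i \<in> {1..t} \<Longrightarrow> h i = poly_saturation P (mpoly_subst gs (H i)) g"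
  shows "S \<subseteq> algebra_generated P (colon P S g) \<and>
    algebra_generated P (colon P S g)
      = algebra_generated P (gs ` {1..r} \<union> h_tilde ` {1..t}) \<and>
    algebra_generated P (gs ` {1..r} \<union> h_tilde ` {1..t})
      \<subseteq> algebra_generated P (gs ` {1..r} \<union> h ` {1..t}) \<and>
    algebra_generated P (gs ` {1..r} \<union> h ` {1..t}) \<subseteq> colon_saturation P S g"
proof -
  let ?R = "mpoly_ring {1..r} :: 'k mpoly ring"
  let ?G = "gs ` {1..r}" and ?T = "gs ` {1..r} \<union> h_tilde ` {1..t}"
    and ?U = "gs ` {1..r} \<union> h ` {1..t}"
  note [simp] = P
  have G: "?G \<subseteq> carrier P" using gs by blast
  have SP: "S \<subseteq> carrier P" using algebra_generated_in_mpoly_ring G S by simp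
  have gS: "g \<in> S" and g0: "g \<noteq> 0" and gP: "g \<in> carrier P" using g SP by auto
  have multS: "x * y \<in> S" if "x \<in> S" "y \<in> S" for x y
    using that mult_in_algebra_generated by (simp add: S)
  have S_colon: "S \<subseteq> colon P S g"
    using SP multS gS by (auto simp: colon_mpoly_ring_iff)
  have colon_P: "colon P S g \<subseteq> carrier P" by (auto simp: colon_mpoly_ring_iff)
  have substS: "mpoly_subst gs F \<in> S" if "F \<in> carrier ?R" for F
    using mpoly_subst_in_algebra_generated[OF that] by (simp add: S)
  have rel_iff: "F \<in> relation_ideal P r gs g \<longleftrightarrow>
      F \<in> carrier ?R \<and> g divides\<^bsub>P\<^esub> mpoly_subst gs F" for F
    using relation_ideal_iff[of gs r "{0..n}" g F] G gP by simp
  interpret R: cring ?R by (rule cring_mpoly_ring)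
  have H_div: "g divides\<^bsub>P\<^esub> mpoly_subst gs (H i)" if "i \<in> {1..t}" for i
    using R.genideal_self[of "H ` {1..t}"] H that Rel rel_iff by blast

  have ht_P: "h_tilde i \<in> carrier P" and ht: "mpoly_subst gs (H i) = g * h_tilde i"
    if i: "i \<in> {1..t}" for i
  proof -
    obtain q where q: "q \<in> carrier P" "mpoly_subst gs (H i) = g * q"
      using H_div[OF i] by (auto simp: mpoly_ring_divides_iff)
    then have "h_tilde i = q"
      using h_tilde[OF i] mpoly_ring_exact_quotient g0 by simp
    then show "h_tilde i \<in> carrier P" "mpoly_subst gs (H i) = g * h_tilde i" using q by auto
  qed
  have T_P: "?T \<subseteq> carrier P" using G ht_P by blast
  have S_T: "S \<subseteq> algebra_generated P ?T"
    using algebra_generated_subset[of ?G "{0..n}" ?T] G generator_in_algebra_generated[of _ ?T]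
    by (auto simp: S)

  have 1: "S \<subseteq> algebra_generated P (colon P S g)"
    using S_colon generator_in_algebra_generated by blast
  have T_colon: "?T \<subseteq> colon P S g"
  proof -
    have "?G \<subseteq> S" unfolding S by (intro subsetI generator_in_algebra_generated)
    moreover have "h_tilde i \<in> colon P S g" if "i \<in> {1..t}" for i
      using ht_P[OF that] ht[OF that] substS[OF H[OF that]] by (simp add: colon_mpoly_ring_iff)
    ultimately show ?thesis using S_colon by blast
  qed
  have colon_T: "colon P S g \<subseteq> algebra_generated P ?T"
  proof
    fix f assume "f \<in> colon P S g"
    then have f: "f \<in> carrier P" "g * f \<in> S" by (auto simp: colon_mpoly_ring_iff)
    let ?J = "{F \<in> carrier ?R. \<exists>q\<in>algebra_generated P ?T. mpoly_subst gs F = g * q}"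
    have "S = mpoly_subst gs ` carrier ?R"
      using algebra_generated_eq_mpoly_subst_image[of gs "{1..r}" "{0..n}"] G unfolding S P .
    then obtain F where F: "F \<in> carrier ?R" "g * f = mpoly_subst gs F"
      using f(2) by blast
    have "g divides\<^bsub>P\<^esub> mpoly_subst gs F"
      using f(1) F(2)[symmetric] by (auto simp: mpoly_ring_divides_iff)
    then have "F \<in> Idl\<^bsub>?R\<^esub> (H ` {1..t})" 
      unfolding Rel rel_iff using F(1) by blast
    also have "\<dots> \<subseteq> ?J"
    proof (rule R.genideal_minimal)
      show "ideal ?J ?R"
        using ideal_mpoly_subst_multiples[of gs "{1..r}" ?T "{0..n}" g] by simp
      show "H ` {1..t} \<subseteq> ?J"
      proof
        fix F assume "F \<in> H ` {1..t}"
        then obtain i where i: "i \<in> {1..t}" "F = H i" by blast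
        then have "h_tilde i \<in> algebra_generated P ?T"
          by (intro generator_in_algebra_generated) blast
        then show "F \<in> ?J" using H[OF i(1)] ht[OF i(1)] i(2) by blast
      qed
    qed
    finally obtain q where "q \<in> algebra_generated P ?T" "g * f = g * q"
      unfolding F(2) by blast
    then show "f \<in> algebra_generated P ?T" using g0 by simp
  qed
  have 2: "algebra_generated P (colon P S g) = algebra_generated P ?T"
  proof
    show "algebra_generated P (colon P S g) \<subseteq> algebra_generated P ?T"
      using algebra_generated_subset[of "colon P S g" "{0..n}" ?T] colon_P colon_T by simp
    have "?T \<subseteq> algebra_generated P (colon P S g)"
      using T_colon generator_in_algebra_generated by blast
    then show "algebra_generated P ?T \<subseteq> algebra_generated P (colon P S g)"
      using algebra_generated_subset[of ?T "{0..n}" "colon P S g"] T_P by simp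
  qed

  have S_U: "S \<subseteq> algebra_generated P ?U"
    using algebra_generated_subset[of ?G "{0..n}" ?U] G generator_in_algebra_generated[of _ ?U]
    by (auto simp: S)
  have h_sat: "h i \<in> colon_saturation P S g" and ht_U: "h_tilde i \<in> algebra_generated P ?U"
    if i: "i \<in> {1..t}" for i
  proof -
    have "mpoly_subst gs (H i) \<in> carrier P" using substS[OF H[OF i]] SP by blast
    then obtain j u where *: "h i \<in> carrier P" "g ^ j * h i = mpoly_subst gs (H i)"
      "h_tilde i = u * h i" "u \<in> range mconst \<union> range (\<lambda>j. g ^ j)"
      using quotient_and_saturation[of "mpoly_subst gs (H i)" "{0..n}" g] g0 H_div[OF i]
        h[OF i] h_tilde[OF i] by (metis P)
    show "h i \<in> colon_saturation P S g"
      using *(1) substS[OF H[OF i]] *(2)[symmetric] unfolding P colon_saturation_mpoly_ring_iff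
      by auto
    have "g ^ j \<in> algebra_generated P ?U" for j
      using subsetD[OF S_U gS] unfolding P by (rule power_in_algebra_generated)
    then have "u \<in> algebra_generated P ?U"
      using *(4) mconst_in_algebra_generated by auto
    moreover have "h i \<in> algebra_generated P ?U"
      using i by (intro generator_in_algebra_generated) blast
    ultimately show "h_tilde i \<in> algebra_generated P ?U"
      using *(3) mult_in_algebra_generated by simp
  qed
  have "?T \<subseteq> algebra_generated P ?U"
    using ht_U generator_in_algebra_generated[of _ ?U P] by blast
  then have 3: "algebra_generated P ?T \<subseteq> algebra_generated P ?U"
    using algebra_generated_subset[of ?T "{0..n}" ?U] T_P by simp
  have "?G \<subseteq> colon_saturation P S g"
  proof
    fix x assume x: "x \<in> ?G"
    then have "g ^ 0 * x \<in> S" by (simp add: S generator_in_algebra_generated)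
    then show "x \<in> colon_saturation P S g"
      using x G unfolding P colon_saturation_mpoly_ring_iff by blast
  qed
  then have "?U \<subseteq> colon_saturation P S g"
    using h_sat by blast
  then have 4: "algebra_generated P ?U \<subseteq> colon_saturation P S g"
    using algebra_generated_subset_colon_saturation[of ?U "{0..n}" ?G g] gS by (simp add: S)
  from 1 2 3 4 show ?thesis by blast
qed

end
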